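(* Let $P_5$ be the undirected path on the five vertices $\texttt{2},\texttt{0},\texttt{1},\hat{\texttt{2}},\hat{\texttt{0}}$ in this order (edges $\texttt{2}\texttt{0}$, $\texttt{0}\texttt{1}$, $\texttt{1}\hat{\texttt{2}}$, $\hat{\texttt{2}}\hat{\texttt{0}}$). Let $k_5$ be the morphism $\texttt{0}\mapsto \texttt{0}\texttt{1}\hat{\texttt{2}}\hat{\texttt{0}}\hat{\texttt{2}}\texttt{1}$, $\texttt{1}\mapsto\texttt{0}\texttt{1}\hat{\texttt{2}}\texttt{1}$, $\texttt{2}\mapsto\texttt{0}\texttt{2}$. Every bi-infinite square-free walk on $P_5$ has the same set of finite factors as $k_5(b_3)$.
   Context: A walk on a graph $G$ is a (finite, infinite or bi-infinite) word over the vertex set of $G$ such that any two consecutive letters are adjacent in $G$. A word is square-free if it contains no factor of the form $uu$ with $u$ nonempty. $b_3$ is the Hall–Thue word, the fixed point starting with $\texttt{0}$ of the morphism $\texttt{0}\mapsto\texttt{012}$, $\texttt{1}\mapsto\texttt{02}$, $\texttt{2}\mapsto\texttt{1}$. *)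

theory Defs
  imports Main
begin

text \<open>
  One-sided infinite words are functions on \<^typ>\<open>nat\<close>, bi-infinite words are functions on
  \<^typ>\<open>int\<close>; \<open>fac_nat\<close> and \<open>fac_int\<close> are their sets of finite factors, including
  the empty one. A graph on a vertex type is given by its set of edges, each an unordered pair
  of vertices.
\<close>

definition fac_nat :: "(nat \<Rightarrow> 'a) \<Rightarrow> 'a list set" where
  "fac_nat w = {map w [i..<j] | i j. True}"

definition fac_int :: "(int \<Rightarrow> 'a) \<Rightarrow> 'a list set" where
  "fac_int w = {map w [i..j] | i j. True}"

definition square_free_int :: "(int \<Rightarrow> 'a) \<Rightarrow> bool" where
  "square_free_int w \<longleftrightarrow> (\<nexists>u. u \<noteq> [] \<and> u @ u \<in> fac_int w)"

definition walk_int :: "'a set set \<Rightarrow> (int \<Rightarrow> 'a) \<Rightarrow> bool" where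
  "walk_int E w \<longleftrightarrow> (\<forall>i. {w i, w (i + 1)} \<in> E)"

text \<open>
  The image of an infinite word under a morphism given by its values on letters. The morphism
  must be non-erasing: the image of the first \<open>n + 1\<close> letters then has a letter at position
  \<open>n\<close>, and its prefixes are the images of the prefixes (\<open>image_nat_prefix\<close> below).
\<close>

definition image_nat :: "('a \<Rightarrow> 'b list) \<Rightarrow> (nat \<Rightarrow> 'a) \<Rightarrow> nat \<Rightarrow> 'b" where
  "image_nat h w n = concat (map h (map w [0..<Suc n])) ! n"

datatype letter = L0 | L1 | L2

fun hall_thue :: "letter \<Rightarrow> letter list" where
  "hall_thue L0 = [L0, L1, L2]"
| "hall_thue L1 = [L0, L2]"
| "hall_thue L2 = [L1]"

text \<open>Existence and uniqueness are shown in \<open>b3_ex1\<close> below.\<close>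

definition b3 :: "nat \<Rightarrow> letter" where
  "b3 = (THE w. w 0 = L0 \<and> image_nat hall_thue w = w)"

text \<open>The vertices \<open>H2\<close> and \<open>H0\<close> are the hatted letters 2 and 0.\<close>

datatype vertex = V2 | V0 | V1 | H2 | H0

definition P5 :: "vertex set set" where
  "P5 = {{V2, V0}, {V0, V1}, {V1, H2}, {H2, H0}}"

fun k5 :: "letter \<Rightarrow> vertex list" where
  "k5 L0 = [V0, V1, H2, H0, H2, V1]"
| "k5 L1 = [V0, V1, H2, V1]"
| "k5 L2 = [V0, V2]"

lemma length_concat_map_ge:
  assumes "\<And>a. h a \<noteq> []"
  shows "length xs \<le> length (concat (map h xs))"
proof (induction xs)
  case (Cons a xs)
  moreover have "Suc 0 \<le> length (h a)" using assms by (simp add: Suc_le_eq)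
  ultimately have "Suc (length xs) \<le> length (h a) + length (concat (map h xs))" by linarith
  then show ?case by simp
qed simp

lemma nth_concat_map_append:
  assumes "n < length (concat (map h xs))"
  shows "concat (map h (xs @ ys)) ! n = concat (map h xs) ! n"
  using assms by (simp add: nth_append)

lemma image_nat_eq:
  assumes h: "\<And>a. h a \<noteq> []" and n: "n < length (concat (map h (map w [0..<m])))"
  shows "image_nat h w n = concat (map h (map w [0..<m])) ! n"
proof (cases "m \<le> Suc n")
  case True
  then have "map w [0..<Suc n] = map w [0..<m] @ map w [m..<Suc n]"
    by (metis le0 le_Suc_ex map_append upt_add_eq_append)
  with nth_concat_map_append[OF n] show ?thesis by (simp only: image_nat_def)
next
  case False
  then have *: "map w [0..<m] = map w [0..<Suc n] @ map w [Suc n..<m]"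
    by (metis le0 le_Suc_ex map_append nat_le_linear upt_add_eq_append)
  have "n < length (concat (map h (map w [0..<Suc n])))"
    using length_concat_map_ge[of h "map w [0..<Suc n]"] h by simp
  from nth_concat_map_append[OF this] show ?thesis by (simp only: image_nat_def *)
qed

lemma image_nat_prefix:
  assumes "\<And>a. h a \<noteq> []"
  shows "map (image_nat h w) [0..<length (concat (map h (map w [0..<m])))]
    = concat (map h (map w [0..<m]))"
  using image_nat_eq[where h = h and w = w and m = m, OF assms]
  by (intro nth_equalityI) (simp_all del: length_concat)

lemma fixed_point_ex1:
  assumes h: "\<And>a. h a \<noteq> []" and a: "h a = a # v" and v: "v \<noteq> []"
  shows "\<exists>!w. w 0 = a \<and> image_nat h w = w"
proof -
  define hs where "hs = (\<lambda>xs. concat (map h xs))"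
  define p where "p k = (hs ^^ k) [a]" for k
  have app: "(hs ^^ k) (xs @ ys) = (hs ^^ k) xs @ (hs ^^ k) ys" for k xs ys
    by (induction k) (simp_all add: hs_def)
  have ne: "(hs ^^ k) v \<noteq> []" for k
  proof (induction k)
    case (Suc k)
    then show ?case using length_concat_map_ge[of h "(hs ^^ k) v"] h by (auto simp: hs_def)
  qed (simp add: v)
  have pS: "p (Suc k) = p k @ (hs ^^ k) v" for k
  proof -
    have "p (Suc k) = (hs ^^ k) (hs [a])" by (simp only: p_def funpow_Suc_right o_apply)
    also have "hs [a] = [a] @ v" by (simp add: hs_def a)
    finally show ?thesis by (simp only: app p_def)
  qed
  have pS': "p (Suc k) = hs (p k)" for k by (simp add: p_def)
  have len: "k < length (p k)" for k
  proof (induction k)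
    case (Suc k)
    have "Suc 0 \<le> length ((hs ^^ k) v)" using ne by (simp add: Suc_le_eq)
    with Suc have "Suc k < length (p k) + length ((hs ^^ k) v)" by linarith
    then show ?case by (simp add: pS)
  qed (simp add: p_def)
  have ext: "\<exists>ys. p (k + d) = p k @ ys" for k d
    by (induction d) (auto simp: pS)
  have cons: "p k ! n = p l ! n" if "n < length (p k)" "n < length (p l)" for n k l
    using ext[of k "l - k"] ext[of l "k - l"] that
    by (cases "k \<le> l") (auto simp: nth_append)
  define w where "w n = p (Suc n) ! n" for n
  have wn: "w n = p k ! n" if "n < length (p k)" for n k
    unfolding w_def using len[of "Suc n"] that by (intro cons) auto
  have wp: "map w [0..<length (p k)] = p k" for k
    by (rule nth_equalityI) (simp_all add: wn)
  show ?thesis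
  proof (rule ex1I[of _ w], intro conjI)
    show "w 0 = a" using wn[of 0 0] by (simp add: p_def)
    show "image_nat h w = w"
    proof
      fix n
      have "n < length (p (Suc n))" using len[of "Suc n"] by simp
      then show "image_nat h w n = w n"
        using image_nat_eq[of h n w "length (p n)"] h
        by (simp add: wp pS' hs_def w_def)
    qed
  next
    fix u assume u: "u 0 = a \<and> image_nat h u = u"
    have up: "map u [0..<length (p k)] = p k" for k
    proof (induction k)
      case 0
      then show ?case using u by (simp add: p_def)
    next
      case (Suc k)
      then show ?case
        using image_nat_prefix[of h u "length (p k)"] h u by (simp add: pS' hs_def)
    qed
    show "u = w"
    proof
      fix n
      have "map u [0..<length (p n)] ! n = map w [0..<length (p n)] ! n" by (simp only: up wp)
      then show "u n = w n" using len[of n] by simp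
    qed
  qed
qed

lemma b3_ex1: "\<exists>!w. w 0 = L0 \<and> image_nat hall_thue w = w"
proof (rule fixed_point_ex1)
  show "hall_thue x \<noteq> []" for x by (cases x) auto
qed auto

lemma b3_0: "b3 0 = L0" and b3_fixed: "image_nat hall_thue b3 = b3"
  using theI'[OF b3_ex1] by (simp_all add: b3_def)

end

theory Submission
  imports Defs "HOL-Library.Sublist"
begin

text \<open>
  Write \<open>h\<close> for the Hall--Thue morphism. Excluding a few short squares forces every return of the
  walk to \<open>V0\<close> to be one of the three images under \<open>k5\<close>, so the walk is \<open>k5(v)\<close> for a bi-infinite
  ternary word \<open>v\<close>, which is square-free and avoids 010 and 212. A word with these properties is
  \<open>h(v')\<close> for a word \<open>v'\<close> that has them too, and by iteration \<open>v = h\<^sup>n(v\<^sub>n)\<close> for every \<open>n\<close>.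
  For large \<open>n\<close> a given factor of \<open>v\<close> lies in \<open>h\<^sup>n(ab)\<close> for two distinct letters \<open>a\<close>, \<open>b\<close>; all
  such pairs \<open>ab\<close> occur in \<open>b3 = h\<^sup>n(b3)\<close>. Conversely, a factor of \<open>b3\<close> lies in a prefix
  \<open>h\<^sup>n(0)\<close>, and \<open>v\<^sub>n\<close> contains the letter 0.
\<close>

section \<open>Factors\<close>

abbreviation apply_morphism :: "('a \<Rightarrow> 'b list) \<Rightarrow> 'a list \<Rightarrow> 'b list" where
  "apply_morphism h xs \<equiv> concat (map h xs)"

lemma sublist_apply_morphism:
  "sublist xs ys \<Longrightarrow> sublist (apply_morphism h xs) (apply_morphism h ys)"
  unfolding sublist_def by (metis concat_append map_append)

lemma map_upto_eq_iff:
  "map w [i..i + int (length xs) - 1] = xs \<longleftrightarrow> (\<forall>k<length xs. w (i + int k) = xs ! k)"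
proof -
  have "length (map w [i..i + int (length xs) - 1]) = length xs" by simp
  moreover have "map w [i..i + int (length xs) - 1] ! k = w (i + int k)" if "k < length xs" for k
    using that by simp
  ultimately show ?thesis unfolding list_eq_iff_nth_eq by metis
qed

text \<open>This form treats empty and nonempty factors alike, whereas the bounds
  \<open>i..j\<close> in \<open>fac_int\<close> give the empty word for every
  \<open>j < i\<close>.\<close>

lemma fac_int_iff: "xs \<in> fac_int w \<longleftrightarrow> (\<exists>i. \<forall>k<length xs. w (i + int k) = xs ! k)"
proof
  assume "xs \<in> fac_int w"
  then obtain i j where "xs = map w [i..j]" by (auto simp: fac_int_def)
  then show "\<exists>i. \<forall>k<length xs. w (i + int k) = xs ! k" by (intro exI[of _ i]) auto
next
  assume "\<exists>i. \<forall>k<length xs. w (i + int k) = xs ! k"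
  then obtain i where "map w [i..i + int (length xs) - 1] = xs" unfolding map_upto_eq_iff ..
  then show "xs \<in> fac_int w" unfolding fac_int_def by (metis (mono_tags, lifting) mem_Collect_eq)
qed

lemma fac_int_sublist:
  assumes "xs \<in> fac_int w" "sublist ys xs"
  shows "ys \<in> fac_int w"
proof -
  from assms obtain i ps ss where i: "\<forall>k<length (ps @ ys @ ss). w (i + int k) = (ps @ ys @ ss) ! k"
    by (auto simp: fac_int_iff sublist_def)
  have "w (i + int (length ps) + int k) = ys ! k" if "k < length ys" for k
    using i[rule_format, of "length ps + k"] that by (simp add: nth_append add.assoc)
  then show ?thesis by (auto simp: fac_int_iff)
qed

lemma fac_nat_sublist:
  assumes "xs \<in> fac_nat w" "sublist ys xs"
  shows "ys \<in> fac_nat w"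
proof -
  from assms obtain i j ps ss where eq: "map w [i..<j] = ps @ ys @ ss"
    by (auto simp: fac_nat_def sublist_def)
  have len: "j - i = length ps + length ys + length ss"
    using arg_cong[OF eq, of length] by simp
  have "ys = map w [i + length ps..<i + length ps + length ys]"
  proof (rule nth_equalityI)
    fix k assume k: "k < length ys"
    then have "map w [i..<j] ! (length ps + k) = ys ! k" by (simp add: eq nth_append)
    with k len show "ys ! k = map w [i + length ps..<i + length ps + length ys] ! k"
      by (simp add: add.assoc)
  qed simp
  then show ?thesis by (auto simp: fac_nat_def)
qed

lemma fac_nat_sublist_prefix: "xs \<in> fac_nat w \<Longrightarrow> \<exists>m. sublist xs (map w [0..<m])"
proof -
  assume "xs \<in> fac_nat w"
  then obtain i j where xs: "xs = map w [i..<j]" by (auto simp: fac_nat_def)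
  show ?thesis
  proof (cases "i \<le> j")
    case True
    then have "map w [0..<j] = map w [0..<i] @ xs @ []"
      unfolding xs by (metis append_Nil2 le0 le_Suc_ex map_append upt_add_eq_append)
    then show ?thesis by (metis sublist_appendI)
  qed (simp add: xs)
qed

lemma prefix_in_fac_nat: "map w [0..<m] \<in> fac_nat w"
  by (auto simp: fac_nat_def)

text \<open>As \<open>h\<close> erases no letter, the first \<open>m\<close> letters of the image
  lie within the image of the first \<open>m\<close> letters. The form matches
  \<open>parsing_fac_int_iff\<close>, so that equal factor sets of two words carry over to their
  images.\<close>

lemma fac_nat_image_nat_iff:
  assumes h: "\<And>a. h a \<noteq> []"
  shows "xs \<in> fac_nat (image_nat h w) \<longleftrightarrow> (\<exists>ys\<in>fac_nat w. sublist xs (apply_morphism h ys))"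
proof
  assume "xs \<in> fac_nat (image_nat h w)"
  then obtain m where m: "sublist xs (map (image_nat h w) [0..<m])"
    using fac_nat_sublist_prefix by blast
  define l where "l = length (apply_morphism h (map w [0..<m]))"
  have "m \<le> l" using length_concat_map_ge[of h "map w [0..<m]"] h by (simp add: l_def)
  then have "[0..<l] = [0..<m] @ [m..<l]" by (metis le0 le_Suc_ex upt_add_eq_append)
  then have "sublist (map (image_nat h w) [0..<m]) (map (image_nat h w) [0..<l])"
    by simp
  also have "map (image_nat h w) [0..<l] = apply_morphism h (map w [0..<m])"
    unfolding l_def by (rule image_nat_prefix) (rule h)
  finally show "\<exists>ys\<in>fac_nat w. sublist xs (apply_morphism h ys)"
    using m prefix_in_fac_nat sublist_order.order_trans by blast
next
  assume "\<exists>ys\<in>fac_nat w. sublist xs (apply_morphism h ys)"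
  then obtain ys m where "sublist xs (apply_morphism h ys)" "sublist ys (map w [0..<m])"
    using fac_nat_sublist_prefix by blast
  then have "sublist xs (apply_morphism h (map w [0..<m]))"
    using sublist_apply_morphism sublist_order.order_trans by blast
  moreover have "apply_morphism h (map w [0..<m]) \<in> fac_nat (image_nat h w)"
    using image_nat_prefix[of h w m] h prefix_in_fac_nat by metis
  ultimately show "xs \<in> fac_nat (image_nat h w)" using fac_nat_sublist by blast
qed

section \<open>Positional forms of square-freeness, for roots of length 1, 2 and 4\<close>

lemma square_free_no_square:
  assumes "square_free_int w" "0 < l"
  shows "\<exists>k<l. w (i + int k) \<noteq> w (i + int l + int k)"
proof (rule ccontr)
  assume "\<not> ?thesis"
  then have eq: "w (i + int l + int k) = w (i + int k)" if "k < l" for k using that by auto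
  define u where "u = map w [i..i + int l - 1]"
  have len: "length u = l" by (simp add: u_def)
  have u: "u ! k = w (i + int k)" if "k < l" for k using that by (simp add: u_def)
  have "w (i + int k) = (u @ u) ! k" if "k < length (u @ u)" for k
  proof (cases "k < l")
    case False
    then show ?thesis using eq[of "k - l"] that u[of "k - l"] by (simp add: nth_append len)
  qed (simp add: u nth_append len)
  then have "u @ u \<in> fac_int w" unfolding fac_int_iff by blast
  moreover have "u \<noteq> []" using len assms by auto
  ultimately show False using assms(1) by (auto simp: square_free_int_def)
qed

lemma square_free_adjacent:
  "square_free_int w \<Longrightarrow> w i \<noteq> w (i + 1)"
  using square_free_no_square[of w 1 i] by auto

lemma square_free_period2:
  assumes "square_free_int w" "w i = w (i + 2)"
  shows "w (i + 1) \<noteq> w (i + 3)"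
proof -
  obtain k where k: "k < 2" "w (i + int k) \<noteq> w (i + 2 + int k)"
    using square_free_no_square[OF assms(1), of 2 i] by auto
  then consider "k = 0" | "k = 1" by linarith
  then show ?thesis using k(2) assms(2) by cases (auto simp: add.assoc)
qed

lemma square_free_period4:
  assumes "square_free_int w" "w i = w (i + 4)" "w (i + 1) = w (i + 5)" "w (i + 2) = w (i + 6)"
  shows "w (i + 3) \<noteq> w (i + 7)"
proof -
  obtain k where k: "k < 4" "w (i + int k) \<noteq> w (i + 4 + int k)"
    using square_free_no_square[OF assms(1), of 4 i] by auto
  then consider "k = 0" | "k = 1" | "k = 2" | "k = 3" by linarith
  then show ?thesis using k(2) assms(2-4) by cases (auto simp: add.assoc)
qed

lemma square_free_not_fac:
  assumes "square_free_int w" "xs \<in> fac_int w" "xs = ps @ u @ u @ ss"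
  shows "u = []"
proof -
  have "sublist (u @ u) (ps @ (u @ u) @ ss)" by (rule sublist_appendI)
  then have "u @ u \<in> fac_int w" using assms fac_int_sublist by (metis append.assoc)
  then show ?thesis using assms(1) by (auto simp: square_free_int_def)
qed

section \<open>Parsing bi-infinite words\<close>

text \<open>The map \<open>p\<close> lists the cut positions: the \<open>n\<close>-th letter of \<open>v\<close> accounts for the positions
  \<open>p n, \<dots>, p (n + 1) - 1\<close> of \<open>w\<close>.\<close>

definition parsing :: "('a \<Rightarrow> 'b list) \<Rightarrow> (int \<Rightarrow> 'a) \<Rightarrow> (int \<Rightarrow> 'b) \<Rightarrow> (int \<Rightarrow> int) \<Rightarrow> bool" where
  "parsing h v w p \<longleftrightarrow> (\<forall>n. p n < p (n + 1) \<and> map w [p n..p (n + 1) - 1] = h (v n))"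

lemma parsing_less: "parsing h v w p \<Longrightarrow> p n < p (n + 1)"
  and parsing_block: "parsing h v w p \<Longrightarrow> map w [p n..p (n + 1) - 1] = h (v n)"
  unfolding parsing_def by blast+

lemma parsing_step:
  assumes "parsing h v w p"
  shows "p (n + 1) = p n + int (length (h (v n)))"
  using arg_cong[OF parsing_block[OF assms, of n], of length] parsing_less[OF assms, of n] by simp

lemma parsing_factor_nat:
  assumes "parsing h v w p"
  shows "p i \<le> p (i + int d) \<and>
    map w [p i..p (i + int d) - 1] = apply_morphism h (map v [i..i + int d - 1])"
proof (induction d)
  case (Suc d)
  let ?j = "i + int d"
  note j = parsing_less[OF assms, of ?j] parsing_block[OF assms, of ?j]
  have le: "p i \<le> p ?j" using Suc ..
  have "[p i..p (?j + 1) - 1] = [p i..p ?j - 1] @ [p ?j..p (?j + 1) - 1]"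
    using le j(1) by (intro upto_split1) auto
  then have "map w [p i..p (?j + 1) - 1]
      = apply_morphism h (map v [i..?j - 1]) @ h (v ?j)"
    by (simp only: map_append j(2) conjunct2[OF Suc])
  moreover have "[i..?j] = [i..?j - 1] @ [?j]" by (rule upto_rec2) simp
  moreover have Suc_d: "i + int (Suc d) = ?j + 1" by simp
  ultimately show ?case unfolding Suc_d using le j(1) by simp
qed simp

lemma parsing_factor:
  assumes "parsing h v w p" "i \<le> j"
  shows "p i \<le> p j" "map w [p i..p j - 1] = apply_morphism h (map v [i..j - 1])"
  using parsing_factor_nat[OF assms(1), of i "nat (j - i)"] assms(2) by auto

lemma parsing_id: "parsing (\<lambda>a. [a]) v v (\<lambda>n. n)"
  by (simp add: parsing_def)

text \<open>This is what lets desubstitution be iterated: the coarse cuts are the cuts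
  \<open>p\<close> at the indices \<open>q n\<close>. Strict monotonicity of \<open>p\<close> keeps
  the composed blocks nonempty.\<close>

lemma parsing_comp:
  assumes "parsing h v w p" "parsing g u v q"
  shows "parsing (\<lambda>a. apply_morphism h (g a)) u w (p \<circ> q)"
proof -
  have mono: "p i < p j" if "i < j" for i j
  proof -
    have "p i < p (i + 1)" using assms(1) by (rule parsing_less)
    also have "\<dots> \<le> p j" using parsing_factor(1)[OF assms(1)] that by simp
    finally show ?thesis .
  qed
  show ?thesis
    unfolding parsing_def
  proof (intro allI conjI)
    fix n
    have q: "q n < q (n + 1)" using assms(2) by (rule parsing_less)
    then show "(p \<circ> q) n < (p \<circ> q) (n + 1)" using mono by simp
    show "map w [(p \<circ> q) n..(p \<circ> q) (n + 1) - 1] = apply_morphism h (g (u n))"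
      using parsing_factor(2)[OF assms(1), of "q n" "q (n + 1)"] q parsing_block[OF assms(2), of n]
      by simp
  qed
qed

text \<open>Strictly increasing integers are unbounded in both directions, so there is a last cut at
  or before \<open>i\<close>.\<close>

lemma parsing_block_ex:
  assumes "parsing h v w p"
  shows "\<exists>n. p n \<le> i \<and> i < p (n + 1)"
proof -
  note step = parsing_less[OF assms]
  have up: "p 0 + int d \<le> p (int d)" for d
  proof (induction d)
    case (Suc d)
    then show ?case using step[of "int d"] by (simp add: algebra_simps)
  qed simp
  have down: "p (- int d) \<le> p 0 - int d" for d
  proof (induction d)
    case (Suc d)
    then show ?case using step[of "- int (Suc d)"] by simp
  qed simp
  \<comment> \<open>Going left by \<open>d\<close> indices lowers the cut by at least
    \<open>d\<close>, so this many suffice to reach \<open>i\<close>; if \<open>p 0\<close> is at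
    most \<open>i\<close> already, then \<open>a = 0\<close>.\<close>
  define a where "a = - int (nat (p 0 - i))"
  have a: "p a \<le> i" using down[of "nat (p 0 - i)"] parsing_factor(1)[OF assms, of a 0]
    unfolding a_def by linarith
  define P where "P d \<longleftrightarrow> i < p (a + int d)" for d
  have "P (nat (int (nat (i - p 0)) + 1 - a))"
  proof -
    have "a + int (nat (int (nat (i - p 0)) + 1 - a)) = int (nat (i - p 0) + 1)"
      by (simp add: a_def)
    then show ?thesis using up[of "nat (i - p 0) + 1"] by (simp only: P_def)
  qed
  moreover have "\<not> P 0" using a by (simp add: P_def)
  ultimately obtain d where "\<not> P d" "P (Suc d)" using dec_induct[of 0 _ "\<lambda>d. \<not> P d"] by blast
  then show ?thesis by (intro exI[of _ "a + int d"]) (auto simp: P_def algebra_simps)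
qed

section \<open>Factors of a parsed word\<close>

lemma parsing_fac_int_apply:
  assumes "parsing h v w p" "xs \<in> fac_int v"
  shows "apply_morphism h xs \<in> fac_int w"
proof -
  obtain i j where xs: "xs = map v [i..j]" using assms(2) by (auto simp: fac_int_def)
  show ?thesis
  proof (cases "i \<le> j + 1")
    case True
    then have "apply_morphism h xs = map w [p i..p (j + 1) - 1]"
      using parsing_factor(2)[OF assms(1), of i "j + 1"] xs by simp
    then show ?thesis by (auto simp: fac_int_def)
  qed (auto simp: xs fac_int_iff)
qed

lemma sublist_map_upto:
  assumes "a \<le> i" "j \<le> b" "i \<le> j + 1"
  shows "sublist (map w [i..j]) (map w [a..b])"
proof -
  have "[a..b] = [a..i - 1] @ [i..b]" using assms by (cases "i = b + 1") (auto intro: upto_split1)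
  moreover have "[i..b] = [i..j] @ [j + 1..b]"
    using assms by (cases "i = j + 1") (auto intro: upto_split2)
  ultimately have "map w [a..b] = map w [a..i - 1] @ map w [i..j] @ map w [j + 1..b]" by simp
  then show ?thesis by (metis sublist_appendI)
qed

lemma parsing_fac_int_cover:
  assumes "parsing h v w p" "xs \<in> fac_int w"
  shows "\<exists>ys\<in>fac_int v. sublist xs (apply_morphism h ys)"
proof (cases "xs = []")
  case True
  then show ?thesis by (intro bexI[of _ "[]"]) (auto simp: fac_int_iff)
next
  case False
  obtain i j where xs: "xs = map w [i..j]" using assms(2) by (auto simp: fac_int_def)
  then have ij: "i \<le> j" using False by simp
  obtain m n where m: "p m \<le> i" "i < p (m + 1)" and n: "p n \<le> j" "j < p (n + 1)"
    using parsing_block_ex[OF assms(1)] by meson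
  have "m \<le> n"
  proof (rule ccontr)
    assume "\<not> m \<le> n"
    then have "p (n + 1) \<le> p m" using parsing_factor(1)[OF assms(1)] by simp
    then show False using m n ij by simp
  qed
  then have "map w [p m..p (n + 1) - 1] = apply_morphism h (map v [m..n])"
    using parsing_factor(2)[OF assms(1), of m "n + 1"] by simp
  moreover have "sublist xs (map w [p m..p (n + 1) - 1])"
    unfolding xs using m n ij by (intro sublist_map_upto) auto
  moreover have "map v [m..n] \<in> fac_int v" by (auto simp: fac_int_def)
  ultimately show ?thesis by metis
qed

lemma parsing_fac_int_iff:
  assumes "parsing h v w p"
  shows "xs \<in> fac_int w \<longleftrightarrow> (\<exists>ys\<in>fac_int v. sublist xs (apply_morphism h ys))"
  using parsing_fac_int_cover[OF assms] parsing_fac_int_apply[OF assms] fac_int_sublist by blast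

text \<open>A factor that starts in block \<open>n\<close> cannot run past block
  \<open>n + 1\<close>, which is at least as long as the factor.\<close>

lemma parsing_short_factor:
  assumes p: "parsing h v w p" and xs: "xs \<in> fac_int w"
    and len: "\<And>a. length xs \<le> length (h a)"
  shows "\<exists>n. sublist xs (apply_morphism h [v n, v (n + 1)])"
proof -
  obtain i where "\<forall>k<length xs. w (i + int k) = xs ! k" using xs by (auto simp: fac_int_iff)
  then have i: "xs = map w [i..i + int (length xs) - 1]" unfolding map_upto_eq_iff[symmetric] ..
  obtain n where n: "p n \<le> i" "i < p (n + 1)" using parsing_block_ex[OF p] by blast
  have "p (n + 2) = p (n + 1) + int (length (h (v (n + 1))))"
    using parsing_step[OF p, of "n + 1"] by (simp add: algebra_simps)
  then have "i + int (length xs) - 1 \<le> p (n + 2) - 1" using n len[of "v (n + 1)"] by linarith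
  then have "sublist xs (map w [p n..p (n + 2) - 1])"
    using n sublist_map_upto[of "p n" i "i + int (length xs) - 1" "p (n + 2) - 1" w] i by simp
  also have "map w [p n..p (n + 2) - 1] = apply_morphism h (map v [n..n + 1])"
    using parsing_factor(2)[OF p, of n "n + 2"] by (simp add: add.commute)
  also have "[n..n + 1] = [n, n + 1]" by (simp add: upto_rec1)
  finally show ?thesis by auto
qed

lemma parsing_square_free:
  assumes p: "parsing h v w p" and w: "square_free_int w" and h: "\<And>a. h a \<noteq> []"
  shows "square_free_int v"
  unfolding square_free_int_def
proof (intro notI, elim exE conjE)
  fix u assume u: "u \<noteq> []" "u @ u \<in> fac_int v"
  then have "apply_morphism h u @ apply_morphism h u \<in> fac_int w"
    using parsing_fac_int_apply[OF p, of "u @ u"] by simp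
  moreover have "apply_morphism h u \<noteq> []" using u(1) h by (cases u) auto
  ultimately show False using w unfolding square_free_int_def by blast
qed

text \<open>\<open>C\<close> is the set of admissible cuts. Blocks are chosen forwards to the right
  of \<open>c\<close> and backwards to its left, so the two choices never have to agree.\<close>

lemma parsing_ex:
  assumes h: "\<And>a. h a \<noteq> []" and c: "c \<in> C"
    and fwd: "\<And>i. i \<in> C \<Longrightarrow> \<exists>a. i + int (length (h a)) \<in> C \<and>
      (\<forall>k<length (h a). w (i + int k) = h a ! k)"
    and bwd: "\<And>i. i \<in> C \<Longrightarrow> \<exists>a. i - int (length (h a)) \<in> C \<and>
      (\<forall>k<length (h a). w (i - int (length (h a)) + int k) = h a ! k)"
  shows "\<exists>v p. parsing h v w p"
proof -
  obtain f where f: "\<And>i. i \<in> C \<Longrightarrow> i + int (length (h (f i))) \<in> C"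
      "\<And>i. i \<in> C \<Longrightarrow> map w [i..i + int (length (h (f i))) - 1] = h (f i)"
    using fwd unfolding map_upto_eq_iff[symmetric] by metis
  obtain b where b: "\<And>i. i \<in> C \<Longrightarrow> i - int (length (h (b i))) \<in> C"
      "\<And>i. i \<in> C \<Longrightarrow> map w [i - int (length (h (b i)))
        ..i - int (length (h (b i))) + int (length (h (b i))) - 1] = h (b i)"
    using bwd unfolding map_upto_eq_iff[symmetric] by metis
  define s where "s i = i + int (length (h (f i)))" for i
  define t where "t i = i - int (length (h (b i)))" for i
  define p where "p n = (if n \<ge> 0 then (s ^^ nat n) c else (t ^^ nat (- n)) c)" for n
  \<comment> \<open>A block of negative index is found from its right end, the cut
    \<open>p (n + 1)\<close>.\<close>
  define v where "v n = (if n \<ge> 0 then f (p n) else b (p (n + 1)))" for n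
  have "(s ^^ k) c \<in> C" "(t ^^ k) c \<in> C" for k
    by (induction k) (auto simp: c s_def t_def f b)
  then have pC: "p n \<in> C" for n by (simp add: p_def)
  have "p n < p (n + 1) \<and> map w [p n..p (n + 1) - 1] = h (v n)" for n
  proof (cases "n \<ge> 0")
    case True
    then have "p (n + 1) = s (p n)" by (simp add: p_def nat_add_distrib)
    then show ?thesis using True f(2)[OF pC] h by (simp add: v_def s_def)
  next
    case False
    then have "nat (- n) = Suc (nat (- (n + 1)))" by simp
    then have "p n = t (p (n + 1))" using False
      by (cases "n = -1") (auto simp: p_def)
    then show ?thesis using False b(2)[OF pC[of "n + 1"]] h by (simp add: v_def t_def)
  qed
  then show ?thesis unfolding parsing_def by blast
qed

section \<open>Ternary square-free words avoiding 010 and 212\<close>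

text \<open>This class is closed under desubstitution by \<open>hall_thue\<close>, which plain
  square-freeness does not provide. By \<open>thue_word_fac_int\<close>, each member has the factors
  of \<open>b3\<close>.\<close>

definition thue_word :: "(int \<Rightarrow> letter) \<Rightarrow> bool" where
  "thue_word v \<longleftrightarrow> square_free_int v \<and> [L0, L1, L0] \<notin> fac_int v \<and> [L2, L1, L2] \<notin> fac_int v"

lemma thue_word_square_free: "thue_word v \<Longrightarrow> square_free_int v"
  by (simp add: thue_word_def)

lemma fac_int3: "v i = a \<Longrightarrow> v (i + 1) = b \<Longrightarrow> v (i + 2) = c \<Longrightarrow> [a, b, c] \<in> fac_int v"
  unfolding fac_int_iff by (rule exI[of _ i]) (auto simp: less_Suc_eq numeral_2_eq_2)

lemma thue_word_no_010: "thue_word v \<Longrightarrow> v i = L0 \<Longrightarrow> v (i + 1) = L1 \<Longrightarrow> v (i + 2) \<noteq> L0"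
  using fac_int3[of v i] by (auto simp: thue_word_def)

lemma thue_word_no_212: "thue_word v \<Longrightarrow> v i = L2 \<Longrightarrow> v (i + 1) = L1 \<Longrightarrow> v (i + 2) \<noteq> L2"
  using fac_int3[of v i] by (auto simp: thue_word_def)

text \<open>With only two letters left, equal neighbours being excluded, the word alternates and has
  a square with a root of length 2.\<close>

lemma square_free_ternary_L0:
  assumes "square_free_int v"
  shows "\<exists>i. v i = L0"
proof (rule ccontr)
  assume "\<nexists>i. v i = L0"
  then have "v i \<noteq> L0" for i by simp
  then have "v i = L1 \<or> v i = L2" for i by (metis letter.exhaust)
  then show False
    using square_free_adjacent[OF assms, of 0] square_free_adjacent[OF assms, of 1]
      square_free_adjacent[OF assms, of 2] square_free_period2[OF assms, of 0]
    by simp metis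
qed

lemma extend_factor:
  assumes "xs \<in> fac_int v"
  shows "\<exists>a b. a # xs @ [b] \<in> fac_int v"
proof -
  obtain i where i: "\<forall>k<length xs. v (i + int k) = xs ! k" using assms by (auto simp: fac_int_iff)
  let ?ys = "v (i - 1) # xs @ [v (i + int (length xs))]"
  have "v (i - 1 + int k) = ?ys ! k" if "k < length ?ys" for k
  proof (cases k)
    case (Suc l)
    then show ?thesis using that i by (cases "l = length xs") (auto simp: nth_append)
  qed simp
  then show ?thesis unfolding fac_int_iff by blast
qed

section \<open>Desubstitution by the Hall-Thue morphism\<close>

lemma hall_thue_nonempty: "hall_thue a \<noteq> []"
  by (cases a) auto

lemma k5_nonempty: "k5 a \<noteq> []"
  by (cases a) auto

text \<open>The image of 010 contains 2020; that of 212, flanked by letters other than 2,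
  contains 210210.\<close>

lemma parsing_hall_thue_thue_word:
  assumes p: "parsing hall_thue u v p" and v: "square_free_int v"
  shows "thue_word u"
proof -
  have u: "square_free_int u" using parsing_square_free[OF p v hall_thue_nonempty] .
  have "[L0, L1, L0] \<notin> fac_int u"
  proof
    assume "[L0, L1, L0] \<in> fac_int u"
    from square_free_not_fac[OF v parsing_fac_int_apply[OF p this], of "[L0, L1]" "[L2, L0]" "[L1, L2]"]
    show False by simp
  qed
  moreover have "[L2, L1, L2] \<notin> fac_int u"
  proof
    assume "[L2, L1, L2] \<in> fac_int u"
    then obtain a b where ab: "[a, L2, L1, L2, b] \<in> fac_int u"
      using extend_factor[of "[L2, L1, L2]" u] by auto
    \<comment> \<open>Next to 2, both \<open>a\<close> and \<open>b\<close> must be 0 or 1; the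
      images of these letters end in 2 and begin with 0, which completes the square.\<close>
    have "a \<noteq> L2" using square_free_not_fac[OF u ab, of "[]" "[L2]"] by auto
    then obtain ps where ps: "hall_thue a = ps @ [L2]" by (cases a) auto
    have "b \<noteq> L2" using square_free_not_fac[OF u ab, of "[a, L2, L1]" "[L2]" "[]"] by auto
    then obtain ss where ss: "hall_thue b = L0 # ss" by (cases b) auto
    show False
      using square_free_not_fac[OF v parsing_fac_int_apply[OF p ab], of ps "[L2, L1, L0]" ss]
      by (simp add: ps ss)
  qed
  ultimately show ?thesis using u by (simp add: thue_word_def)
qed

text \<open>A letter 1 is the image of 2, rather than the middle of the image of 0, exactly when it is
  not preceded by 0.\<close>

lemma thue_word_desubstitute:
  assumes v: "thue_word v"
  shows "\<exists>u p. parsing hall_thue u v p \<and> thue_word u"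
proof -
  note sf = thue_word_square_free[OF v]
  define C where "C = {i. v i = L0 \<or> v i = L1 \<and> v (i - 1) \<noteq> L0}"
  obtain c where "v c = L0" using square_free_ternary_L0[OF sf] by blast
  then have "c \<in> C" by (simp add: C_def)
  moreover have "\<exists>a. i + int (length (hall_thue a)) \<in> C \<and>
      (\<forall>k<length (hall_thue a). v (i + int k) = hall_thue a ! k)" if iC: "i \<in> C" for i
  proof -
    have adj: "v (i - 1) \<noteq> v i" "v i \<noteq> v (i + 1)" "v (i + 1) \<noteq> v (i + 2)" "v (i + 2) \<noteq> v (i + 3)"
      using square_free_adjacent[OF sf, of "i - 1"] square_free_adjacent[OF sf, of i]
        square_free_adjacent[OF sf, of "i + 1"] square_free_adjacent[OF sf, of "i + 2"]
      by (simp_all add: algebra_simps)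
    have av: "v i = L0 \<Longrightarrow> v (i + 1) = L1 \<Longrightarrow> v (i + 2) \<noteq> L0"
        "v (i - 1) = L2 \<Longrightarrow> v i = L1 \<Longrightarrow> v (i + 1) \<noteq> L2"
      using thue_word_no_010[OF v, of i] thue_word_no_212[OF v, of "i - 1"]
      by (simp_all add: algebra_simps)
    \<comment> \<open>The block is read off its first letters: 1 comes from 2, 01 begins the image
      of 0, and 02 is the image of 1.\<close>
    consider "v i = L1" | "v i = L0" "v (i + 1) = L1" | "v i = L0" "v (i + 1) = L2"
      using iC adj unfolding C_def by (cases "v (i + 1)") auto
    then show ?thesis
    proof cases
      case 1
      \<comment> \<open>The cut condition makes the preceding letter 2, so avoiding 212 leaves only
        0 as the next letter.\<close>
      then have "v (i + 1) = L0" using iC adj av unfolding C_def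
        by (cases "v (i - 1)"; cases "v (i + 1)") auto
      then show ?thesis using 1 by (intro exI[of _ L2]) (auto simp: C_def)
    next
      case 2
      \<comment> \<open>Avoiding 010 completes 012. The letter after it is 0, or a 1 preceded by 2,
        and is a cut either way.\<close>
      then have "v (i + 2) = L2" "v (i + 3) \<noteq> L2" using adj av
        by (cases "v (i + 2)"; auto)+
      then show ?thesis using 2
        by (intro exI[of _ L0], cases "v (i + 3)")
          (auto simp: C_def less_Suc_eq numeral_2_eq_2 algebra_simps)
    next
      case 3
      then have "v (i + 2) \<noteq> L2" using adj by auto
      then show ?thesis using 3
        by (intro exI[of _ L1], cases "v (i + 2)")
          (auto simp: C_def less_Suc_eq numeral_2_eq_2 algebra_simps)
    qed
  qed
  moreover have "\<exists>a. i - int (length (hall_thue a)) \<in> C \<and>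
      (\<forall>k<length (hall_thue a). v (i - int (length (hall_thue a)) + int k) = hall_thue a ! k)"
    if iC: "i \<in> C" for i
  proof -
    have adj: "v (i - 1) \<noteq> v i" "v (i - 2) \<noteq> v (i - 1)" "v (i - 3) \<noteq> v (i - 2)"
      using square_free_adjacent[OF sf, of "i - 1"] square_free_adjacent[OF sf, of "i - 2"]
        square_free_adjacent[OF sf, of "i - 3"]
      by simp_all
    have av: "v (i - 2) = L0 \<Longrightarrow> v (i - 1) = L1 \<Longrightarrow> v i \<noteq> L0"
        "v (i - 3) = L2 \<Longrightarrow> v (i - 2) = L1 \<Longrightarrow> v (i - 1) \<noteq> L2"
      using thue_word_no_010[OF v, of "i - 2"] thue_word_no_212[OF v, of "i - 3"] by simp_all
    \<comment> \<open>No block ends in 0. A block ending in 1 is the image of 2; for one ending in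
      2, the letter before it distinguishes 02 from 012.\<close>
    have "v (i - 1) \<noteq> L0" using iC adj by (auto simp: C_def)
    then consider "v (i - 1) = L1" | "v (i - 1) = L2" "v (i - 2) = L0"
      | "v (i - 1) = L2" "v (i - 2) = L1"
      using adj by (cases "v (i - 1)"; cases "v (i - 2)") auto
    then show ?thesis
    proof cases
      case 1
      then have "v i = L0" using iC adj by (auto simp: C_def)
      then have "v (i - 2) \<noteq> L0" using 1 av by auto
      then show ?thesis using 1 by (intro exI[of _ L2]) (auto simp: C_def)
    next
      case 2
      then show ?thesis
        by (intro exI[of _ L1]) (auto simp: C_def less_Suc_eq numeral_2_eq_2 algebra_simps)
    next
      case 3
      then have "v (i - 3) = L0" using adj av by (cases "v (i - 3)") auto
      then show ?thesis using 3
        by (intro exI[of _ L0]) (auto simp: C_def less_Suc_eq numeral_2_eq_2 algebra_simps)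
    qed
  qed
  ultimately obtain u p where "parsing hall_thue u v p"
    using parsing_ex[of hall_thue c C v] hall_thue_nonempty by blast
  then show ?thesis using parsing_hall_thue_thue_word sf by blast
qed

section \<open>Powers of the Hall-Thue morphism\<close>

definition hall_thue_pow :: "nat \<Rightarrow> letter list \<Rightarrow> letter list" where
  "hall_thue_pow n = (apply_morphism hall_thue ^^ n)"

lemma hall_thue_pow_0: "hall_thue_pow 0 xs = xs"
  and hall_thue_pow_Suc: "hall_thue_pow (Suc n) xs = apply_morphism hall_thue (hall_thue_pow n xs)"
  by (simp_all add: hall_thue_pow_def)

lemma hall_thue_pow_Nil: "hall_thue_pow n [] = []"
  by (induction n) (simp_all add: hall_thue_pow_0 hall_thue_pow_Suc)

lemma hall_thue_pow_append:
  "hall_thue_pow n (xs @ ys) = hall_thue_pow n xs @ hall_thue_pow n ys"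
  by (induction n) (simp_all add: hall_thue_pow_0 hall_thue_pow_Suc)

text \<open>Parsings need a map on letters, while iteration takes place on words; this identifies
  the two forms.\<close>

lemma hall_thue_pow_eq_apply:
  "apply_morphism (\<lambda>a. hall_thue_pow n [a]) xs = hall_thue_pow n xs"
proof (induction xs)
  case (Cons a xs)
  then show ?case using hall_thue_pow_append[of n "[a]" xs] by simp
qed (simp add: hall_thue_pow_Nil)

text \<open>One application need not lengthen a word, since 2 goes to 1. Two applications send 0, 1,
  2 to 012021, 0121, 02, so every letter at least doubles. Hence the even exponents below.\<close>

lemma length_hall_thue_twice:
  "2 * length xs \<le> length (apply_morphism hall_thue (apply_morphism hall_thue xs))"
proof (induction xs)
  case (Cons a xs)
  then show ?case by (cases a) (simp_all del: length_concat)
qed simp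

lemma length_hall_thue_pow:
  "xs \<noteq> [] \<Longrightarrow> n < length (hall_thue_pow (2 * n) xs)"
proof (induction n)
  case (Suc n)
  then show ?case using length_hall_thue_twice[of "hall_thue_pow (2 * n) xs"]
    by (simp add: hall_thue_pow_Suc del: length_concat)
qed (simp add: hall_thue_pow_0)

lemma thue_word_desubstitute_pow:
  assumes "thue_word v"
  shows "\<exists>u p. parsing (\<lambda>a. hall_thue_pow n [a]) u v p \<and> thue_word u"
proof (induction n)
  case 0
  then show ?case using parsing_id assms by (auto simp: hall_thue_pow_0)
next
  case (Suc n)
  then obtain u p where u: "parsing (\<lambda>a. hall_thue_pow n [a]) u v p" "thue_word u" by blast
  then obtain t q where t: "parsing hall_thue t u q" "thue_word t"
    using thue_word_desubstitute by blast
  \<comment> \<open>The new power is applied innermost, on the side opposite to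
    \<open>hall_thue_pow_Suc\<close>, as composing parsings requires.\<close>
  have "apply_morphism (\<lambda>a. hall_thue_pow n [a]) (hall_thue a) = hall_thue_pow (Suc n) [a]" for a
    unfolding hall_thue_pow_eq_apply by (simp add: hall_thue_pow_def funpow_Suc_right del: funpow.simps)
  then show ?case using parsing_comp[OF u(1) t(1)] t(2) by auto
qed

section \<open>Factors of the Hall-Thue word\<close>

lemma hall_thue_pow_fac_b3: "xs \<in> fac_nat b3 \<Longrightarrow> hall_thue_pow n xs \<in> fac_nat b3"
proof (induction n)
  case (Suc n)
  then have "hall_thue_pow n xs \<in> fac_nat b3" by blast
  then have "apply_morphism hall_thue (hall_thue_pow n xs) \<in> fac_nat (image_nat hall_thue b3)"
    using fac_nat_image_nat_iff[of hall_thue, OF hall_thue_nonempty] sublist_order.order_refl by blast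
  then show ?case by (simp only: hall_thue_pow_Suc b3_fixed)
qed (simp add: hall_thue_pow_0)

lemma hall_thue_pow_prefix_b3:
  "map b3 [0..<length (hall_thue_pow n [L0])] = hall_thue_pow n [L0]"
proof (induction n)
  case (Suc n)
  then show ?case
    using image_nat_prefix[of hall_thue b3 "length (hall_thue_pow n [L0])"] hall_thue_nonempty
    by (simp add: hall_thue_pow_Suc b3_fixed del: length_concat)
qed (simp add: hall_thue_pow_0 b3_0)

lemma pair_in_fac_b3:
  assumes "a \<noteq> b"
  shows "[a, b] \<in> fac_nat b3"
proof -
  \<comment> \<open>The third power is the first whose value at 0 contains all six pairs: 012021,
    the second, still lacks 10.\<close>
  have "hall_thue_pow 3 [L0] \<in> fac_nat b3"
    using hall_thue_pow_prefix_b3[of 3] prefix_in_fac_nat by metis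
  then have *: "[L0, L1, L2, L0, L2, L1, L0, L1, L2, L1, L0, L2] \<in> fac_nat b3"
    by (simp add: hall_thue_pow_def numeral_3_eq_3)
  show ?thesis
    by (rule fac_nat_sublist[OF *]) (use assms in \<open>cases a; cases b; simp add: sublist_code\<close>)
qed

lemma thue_word_fac_int:
  assumes v: "thue_word v"
  shows "fac_int v = fac_nat b3"
proof (intro equalityI subsetI)
  fix xs assume xs: "xs \<in> fac_int v"
  \<comment> \<open>With this exponent every block is longer than \<open>xs\<close>, so two
    neighbouring blocks cover it.\<close>
  let ?n = "2 * length xs"
  obtain u p where u: "parsing (\<lambda>a. hall_thue_pow ?n [a]) u v p" "thue_word u"
    using thue_word_desubstitute_pow[OF v] by blast
  obtain k where "sublist xs (hall_thue_pow ?n [u k, u (k + 1)])"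
    using parsing_short_factor[OF u(1) xs] length_hall_thue_pow[of "[_]" "length xs"]
    unfolding hall_thue_pow_eq_apply by (meson less_imp_le not_Cons_self2)
  moreover have "u k \<noteq> u (k + 1)" using square_free_adjacent thue_word_square_free u(2) by blast
  ultimately show "xs \<in> fac_nat b3"
    using pair_in_fac_b3 hall_thue_pow_fac_b3 fac_nat_sublist by blast
next
  fix xs assume "xs \<in> fac_nat b3"
  then obtain m where m: "sublist xs (map b3 [0..<m])" using fac_nat_sublist_prefix by blast
  let ?n = "2 * m"
  have "m \<le> length (hall_thue_pow ?n [L0])" using length_hall_thue_pow[of "[L0]" m] by simp
  then have "[0..<length (hall_thue_pow ?n [L0])] = [0..<m] @ [m..<length (hall_thue_pow ?n [L0])]"
    by (metis le0 le_Suc_ex upt_add_eq_append)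
  then have "sublist (map b3 [0..<m]) (hall_thue_pow ?n [L0])"
    using hall_thue_pow_prefix_b3[of ?n] by (metis map_append sublist_append_rightI)
  then have xs: "sublist xs (hall_thue_pow ?n [L0])" using m sublist_order.order_trans by blast
  obtain u p where u: "parsing (\<lambda>a. hall_thue_pow ?n [a]) u v p" "thue_word u"
    using thue_word_desubstitute_pow[OF v] by blast
  obtain i where "u i = L0" using square_free_ternary_L0 thue_word_square_free u(2) by blast
  then have "[L0] \<in> fac_int u" by (auto simp: fac_int_iff)
  from parsing_fac_int_apply[OF u(1) this] xs show "xs \<in> fac_int v"
    using fac_int_sublist by simp
qed

section \<open>Square-free walks on the path\<close>

text \<open>In the images of 010 and of 212 flanked by letters other than 2, the squares have
  roots \<open>H2 V1 V0 V1\<close> and \<open>H2 V1 V0 V2 V0 V1\<close>.\<close>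

lemma parsing_k5_thue_word:
  assumes p: "parsing k5 v w p" and w: "square_free_int w"
  shows "thue_word v"
proof -
  have v: "square_free_int v" using parsing_square_free[OF p w k5_nonempty] .
  have "[L0, L1, L0] \<notin> fac_int v"
  proof
    assume "[L0, L1, L0] \<in> fac_int v"
    from square_free_not_fac[OF w parsing_fac_int_apply[OF p this],
        of "[V0, V1, H2, H0]" "[H2, V1, V0, V1]" "[H2, H0, H2, V1]"]
    show False by simp
  qed
  moreover have "[L2, L1, L2] \<notin> fac_int v"
  proof
    assume "[L2, L1, L2] \<in> fac_int v"
    then obtain a b where ab: "[a, L2, L1, L2, b] \<in> fac_int v"
      using extend_factor[of "[L2, L1, L2]" v] by auto
    have "a \<noteq> L2" using square_free_not_fac[OF v ab, of "[]" "[L2]"] by auto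
    \<comment> \<open>The images of 0 and 1 share the suffix \<open>H2 V1\<close>, used here, and
      the prefix \<open>V0 V1\<close>, used for \<open>b\<close>.\<close>
    then obtain ps where ps: "k5 a = ps @ [H2, V1]" by (cases a) auto
    have "b \<noteq> L2" using square_free_not_fac[OF v ab, of "[a, L2, L1]" "[L2]" "[]"] by auto
    then obtain ss where ss: "k5 b = V0 # V1 # ss" by (cases b) auto
    show False
      using square_free_not_fac[OF w parsing_fac_int_apply[OF p ab],
        of ps "[H2, V1, V0, V2, V0, V1]" ss]
      by (simp add: ps ss)
  qed
  ultimately show ?thesis using v by (simp add: thue_word_def)
qed

section \<open>Returns of a square-free walk to \<open>V0\<close>\<close>

locale square_free_walk =
  fixes w :: "int \<Rightarrow> vertex"
  assumes walk: "walk_int P5 w" and sf: "square_free_int w"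
begin

lemma edge: "{w i, w (i + 1)} \<in> P5"
  using walk by (simp add: walk_int_def)

lemma next_V2: "w i = V2 \<Longrightarrow> w (i + 1) = V0"
  and next_V0: "w i = V0 \<Longrightarrow> w (i + 1) = V2 \<or> w (i + 1) = V1"
  and next_V1: "w i = V1 \<Longrightarrow> w (i + 1) = V0 \<or> w (i + 1) = H2"
  and next_H2: "w i = H2 \<Longrightarrow> w (i + 1) = V1 \<or> w (i + 1) = H0"
  and next_H0: "w i = H0 \<Longrightarrow> w (i + 1) = H2"
  using edge[of i] by (auto simp: P5_def doubleton_eq_iff)

lemma prev_V2: "w i = V2 \<Longrightarrow> w (i - 1) = V0"
  and prev_V0: "w i = V0 \<Longrightarrow> w (i - 1) = V2 \<or> w (i - 1) = V1"
  and prev_V1: "w i = V1 \<Longrightarrow> w (i - 1) = V0 \<or> w (i - 1) = H2"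
  and prev_H2: "w i = H2 \<Longrightarrow> w (i - 1) = V1 \<or> w (i - 1) = H0"
  and prev_H0: "w i = H0 \<Longrightarrow> w (i - 1) = H2"
  using edge[of "i - 1"] by (auto simp: P5_def doubleton_eq_iff)

text \<open>After a turn x y x the walk cannot step to y again. As no vertex has more than two
  neighbours, this determines the next step, and likewise the previous one.\<close>

lemma square2: "w (i + 2) = w i \<Longrightarrow> w (i + 3) \<noteq> w (i + 1)"
  using square_free_period2[OF sf, of i] by auto

text \<open>Around \<open>V0 V1 V0\<close>, avoiding squares of length 4 forces
  \<open>V0 V2 V0 V1 V0 V2 V0 V1\<close>, which is itself a square.\<close>

lemma no_V0_V1_V0:
  assumes "w i = V0" "w (i + 1) = V1"
  shows "w (i + 2) \<noteq> V0"
proof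
  assume 2: "w (i + 2) = V0"
  have 3: "w (i + 3) = V2" using next_V0[OF 2] square2[of i] assms 2 by (auto simp: algebra_simps)
  have 4: "w (i + 4) = V0" using next_V2[OF 3] by (simp add: algebra_simps)
  have 5: "w (i + 5) = V1" using next_V0[OF 4] square2[of "i + 2"] 2 3 4 by (auto simp: algebra_simps)
  have 6: "w (i - 1) = V2" using prev_V0[OF assms(1)] square2[of "i - 1"] assms 2 by (auto simp: algebra_simps)
  have 7: "w (i - 2) = V0" using prev_V2[OF 6] by (simp add: algebra_simps)
  show False using square_free_period4[OF sf, of "i - 2"] assms 2 3 4 5 6 7 by (simp add: algebra_simps)
qed

text \<open>Without \<open>V0\<close> the walk also misses \<open>V2\<close>, whose only neighbour
  is \<open>V0\<close>. Then \<open>H2\<close> fills every second position, and the letters between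
  must alternate between \<open>V1\<close> and \<open>H0\<close>; this repeats with period
  4.\<close>

lemma visits_V0: "\<exists>i. w i = V0"
proof (rule ccontr)
  assume "\<nexists>i. w i = V0"
  then have n0: "w i \<noteq> V0" for i by (simp add: algebra_simps)
  then have n2: "w i \<noteq> V2" for i using next_V2 by metis
  have H2: "w (i + 1) = H2" if "w i \<noteq> H2" for i
    using next_V1[of i] next_H0[of i] that n0 n2 by (cases "w i") auto
  then obtain i where i: "w i = H2" by metis
  have step: "w (j + 2) = H2" if "w j = H2" for j
    using next_H2[OF that] H2[of "j + 1"] by (auto simp: algebra_simps)
  have even: "w (i + 2) = H2" "w (i + 4) = H2" "w (i + 6) = H2"
    using step[OF i] step[of "i + 2"] step[of "i + 4"] by (auto simp: algebra_simps)
  have alt: "w (j + 3) \<noteq> w (j + 1)" if "w j = H2" for j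
    using square2[of j] that step[OF that] by (simp add: algebra_simps)
  have "w (i + 3) \<noteq> w (i + 1)" "w (i + 5) \<noteq> w (i + 3)" "w (i + 7) \<noteq> w (i + 5)"
    using alt[OF i] alt[OF even(1)] alt[OF even(2)] by (simp_all add: algebra_simps)
  moreover have "w (i + 1) \<in> {V1, H0}" "w (i + 3) \<in> {V1, H0}" "w (i + 5) \<in> {V1, H0}"
      "w (i + 7) \<in> {V1, H0}"
    using next_H2[OF i] next_H2[OF even(1)] next_H2[OF even(2)] next_H2[OF even(3)] by (auto simp: algebra_simps)
  ultimately show False using square_free_period4[OF sf, of i] i even by (auto simp: algebra_simps)
qed

text \<open>The walk may turn at \<open>V2\<close>, at \<open>H2\<close> or at \<open>H0\<close>;
  these turns give the images of 2, 1 and 0. Turning back once more before reaching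
  \<open>V0\<close> would create a square.\<close>

lemma block_after_V0:
  assumes i: "w i = V0"
  shows "\<exists>a. w (i + int (length (k5 a))) = V0 \<and> (\<forall>k<length (k5 a). w (i + int k) = k5 a ! k)"
proof (cases "w (i + 1) = V2")
  case True
  then have "w (i + 2) = V0" using next_V2[of "i + 1"] by (simp add: algebra_simps)
  then show ?thesis using i True by (intro exI[of _ L2]) (auto simp: less_Suc_eq algebra_simps)
next
  case False
  then have 1: "w (i + 1) = V1" using next_V0[OF i] by (simp add: algebra_simps)
  have 2: "w (i + 2) = H2" using next_V1[OF 1] no_V0_V1_V0[OF i 1] by (simp add: algebra_simps)
  show ?thesis
  proof (cases "w (i + 3) = V1")
    case True
    then have "w (i + 4) = V0" using next_V1[OF True] square2[of "i + 1"] 1 2 by (simp add: algebra_simps)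
    then show ?thesis using i 1 2 True
      by (intro exI[of _ L1]) (auto simp: less_Suc_eq numeral_2_eq_2 algebra_simps)
  next
    case False
    then have 3: "w (i + 3) = H0" using next_H2[OF 2] by (simp add: algebra_simps)
    have 4: "w (i + 4) = H2" using next_H0[OF 3] by (simp add: algebra_simps)
    have 5: "w (i + 5) = V1" using next_H2[OF 4] square2[of "i + 2"] 2 3 4 by (auto simp: algebra_simps)
    have 6: "w (i + 6) = V0"
    proof (rule ccontr)
      assume "w (i + 6) \<noteq> V0"
      \<comment> \<open>Turning back at \<open>V1\<close> forces another trip to \<open>H0\<close>,
        so \<open>V1 H2 H0 H2\<close> is repeated.\<close>
      then have 6: "w (i + 6) = H2" using next_V1[OF 5] by (simp add: algebra_simps)
      then have "w (i + 7) = H0" using next_H2[OF 6] square2[of "i + 4"] 4 5 by (auto simp: algebra_simps)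
      moreover have "w (i + 8) = H2" using next_H0[OF calculation] by (simp add: algebra_simps)
      ultimately show False using square_free_period4[OF sf, of "i + 1"] 1 2 3 4 5 6 by (simp add: algebra_simps)
    qed
    then show ?thesis using i 1 2 3 4 5
      by (intro exI[of _ L0]) (auto simp: less_Suc_eq numeral_2_eq_2 algebra_simps)
  qed
qed

text \<open>Each image under \<open>k5\<close> followed by \<open>V0\<close> is a palindrome, so the
  forward argument can be mirrored.\<close>

lemma block_before_V0:
  assumes i: "w i = V0"
  shows "\<exists>a. w (i - int (length (k5 a))) = V0 \<and>
    (\<forall>k<length (k5 a). w (i - int (length (k5 a)) + int k) = k5 a ! k)"
proof (cases "w (i - 1) = V2")
  case True
  then have "w (i - 2) = V0" using prev_V2[of "i - 1"] by (simp add: algebra_simps)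
  then show ?thesis using i True by (intro exI[of _ L2]) (auto simp: less_Suc_eq algebra_simps)
next
  case False
  then have 1: "w (i - 1) = V1" using prev_V0[OF i] by (simp add: algebra_simps)
  have 2: "w (i - 2) = H2" using prev_V1[OF 1] no_V0_V1_V0[of "i - 2"] i 1 by (auto simp: algebra_simps)
  show ?thesis
  proof (cases "w (i - 3) = V1")
    case True
    then have "w (i - 4) = V0" using prev_V1[OF True] square2[of "i - 4"] 1 2 by (auto simp: algebra_simps)
    then show ?thesis using i 1 2 True
      by (intro exI[of _ L1]) (auto simp: less_Suc_eq numeral_2_eq_2 algebra_simps)
  next
    case False
    then have 3: "w (i - 3) = H0" using prev_H2[OF 2] by (simp add: algebra_simps)
    have 4: "w (i - 4) = H2" using prev_H0[OF 3] by (simp add: algebra_simps)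
    have 5: "w (i - 5) = V1" using prev_H2[OF 4] square2[of "i - 5"] 2 3 4 by (auto simp: algebra_simps)
    have 6: "w (i - 6) = V0"
    proof (rule ccontr)
      assume "w (i - 6) \<noteq> V0"
      then have 6: "w (i - 6) = H2" using prev_V1[OF 5] by (simp add: algebra_simps)
      then have "w (i - 7) = H0" using prev_H2[OF 6] square2[of "i - 7"] 4 5 by (auto simp: algebra_simps)
      moreover have "w (i - 8) = H2" using prev_H0[OF calculation] by (simp add: algebra_simps)
      ultimately show False using square_free_period4[OF sf, of "i - 8"] 1 2 3 4 5 6 by (simp add: algebra_simps)
    qed
    then show ?thesis using i 1 2 3 4 5
      by (intro exI[of _ L0]) (auto simp: less_Suc_eq numeral_2_eq_2 algebra_simps)
  qed
qed

lemma parsing_k5_ex: "\<exists>v p. parsing k5 v w p"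
proof -
  obtain c where "w c = V0" using visits_V0 by blast
  then show ?thesis
    using parsing_ex[of k5 c "{i. w i = V0}" w] k5_nonempty block_after_V0 block_before_V0 by simp
qed

end

theorem theorem5:
  fixes w :: "int \<Rightarrow> vertex"
  assumes "walk_int P5 w" and "square_free_int w"
  shows "fac_int w = fac_nat (image_nat k5 b3)"
proof -
  interpret square_free_walk w using assms by unfold_locales
  obtain v p where p: "parsing k5 v w p" using parsing_k5_ex by blast
  have "fac_int v = fac_nat b3"
    using thue_word_fac_int parsing_k5_thue_word[OF p assms(2)] by blast
  \<comment> \<open>Both sides consist of the factors of \<open>k5\<close>-images of words from the
    same set.\<close>
  then show ?thesis
    using parsing_fac_int_iff[OF p] fac_nat_image_nat_iff[of k5, OF k5_nonempty] by blast
qed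

end
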